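(* Let $P_1$ and $P_2$ be LPODs. Then $P_1$ and $P_2$ are strongly equivalent under all the answer sets (that is, for every LPOD $P$, the programs $P_1\cup P$ and $P_2\cup P$ have the same answer sets) if and only if $P_1$ and $P_2$ are logically equivalent in the four-valued logic (that is, they have the same models).
   Context: Let $\Sigma$ be a nonempty, countably infinite set of propositional atoms. Formulas are built from atoms using the binary connectives $\wedge$, $\vee$, $\leftarrow$, $\times$ and the unary connective $\mathit{not}$. Truth values are $V=\{F,F^*,T^*,T\}$ ordered $F<F^*<T^*<T$. An interpretation is a function $I:\Sigma\to V$, extended to formulas by: $I(\mathit{not}\,\phi)=T$ if $I(\phi)\le F^*$ and $F$ otherwise; $I(\phi\leftarrow\psi)=T$ if $I(\phi)\ge I(\psi)$ and $F$ otherwise; $I(\phi_1\wedge\phi_2)=\min\{I(\phi_1),I(\phi_2)\}$; $I(\phi_1\vee\phi_2)=\max\{I(\phi_1),I(\phi_2)\}$; $I(\phi_1\times\phi_2)=I(\phi_2)$ if $I(\phi_1)=F^*$ and $I(\phi_1)$ otherwise (these are associative; a comma in a rule body denotes $\wedge$). An LPOD is a finite set of rules $C_1\times\cdots\times C_n\leftarrow A_1,\ldots,A_m,\mathit{not}\,B_1,\ldots,\mathit{not}\,B_k$ with $n\ge1$, $m,k\ge0$ and all $C_i,A_j,B_l$ atoms. An interpretation $I$ is a model of an LPOD $P$ if every rule of $P$ evaluates to $T$ under $I$; two LPODs are logically equivalent if they have the same models. Define the relation $\prec$ on truth values by $F\prec F^*$, $F\prec T^*$, $F\prec T$, $T^*\prec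 T$ (and no other pairs), with $v_1\preceq v_2$ iff $v_1\prec v_2$ or $v_1=v_2$. For interpretations $I_1,I_2$ of $P$, $I_1\preceq I_2$ iff $I_1(A)\preceq I_2(A)$ for all atoms $A$ in $P$, and $I_1\prec I_2$ iff $I_1\preceq I_2$ and $I_1\ne I_2$. An interpretation $I$ is solid if $I(A)\ne T^*$ for all atoms $A$ in $P$. An answer set of $P$ is a solid $\preceq$-minimal model of $P$. *)

theory Defs
  imports Main "HOL-Library.Countable" "HOL-Library.Infinite_Typeclass"
begin

text \<open>Truth values \<open>F < F\<^sup>* < T\<^sup>* < T\<close>; \<open>Fs\<close> and \<open>Ts\<close> stand for \<open>F\<^sup>*\<close> and \<open>T\<^sup>*\<close>.\<close>

datatype tv = F | Fs | Ts | T

fun tv_rank :: "tv \<Rightarrow> nat" where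
  "tv_rank F = 0"
| "tv_rank Fs = 1"
| "tv_rank Ts = 2"
| "tv_rank T = 3"

instantiation tv :: linorder
begin

definition less_eq_tv :: "tv \<Rightarrow> tv \<Rightarrow> bool" where
  "v \<le> w \<longleftrightarrow> tv_rank v \<le> tv_rank w"

definition less_tv :: "tv \<Rightarrow> tv \<Rightarrow> bool" where
  "v < w \<longleftrightarrow> tv_rank v < tv_rank w"

instance
proof
  fix v w :: tv
  show "v \<le> w \<Longrightarrow> w \<le> v \<Longrightarrow> v = w"
    by (cases v; cases w) (auto simp: less_eq_tv_def)
qed (auto simp: less_eq_tv_def less_tv_def)

end

definition naf_val :: "tv \<Rightarrow> tv" where
  "naf_val v = (if v \<le> Fs then T else F)"

text \<open>The first argument is the conclusion: \<open>arrow_val\<close> interprets \<open>\<phi> \<leftarrow> \<psi>\<close>.\<close>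

definition arrow_val :: "tv \<Rightarrow> tv \<Rightarrow> tv" where
  "arrow_val v w = (if v \<ge> w then T else F)"

definition times_val :: "tv \<Rightarrow> tv \<Rightarrow> tv" where
  "times_val v w = (if v = Fs then w else v)"

datatype 'a fm =
    Atom 'a
  | Conj "'a fm" "'a fm"
  | Disj "'a fm" "'a fm"
  | Arrow "'a fm" "'a fm"
  | Times "'a fm" "'a fm"
  | Naf "'a fm"

type_synonym 'a interp = "'a \<Rightarrow> tv"

primrec eval :: "'a interp \<Rightarrow> 'a fm \<Rightarrow> tv" where
  "eval I (Atom A) = I A"
| "eval I (Conj \<phi> \<psi>) = min (eval I \<phi>) (eval I \<psi>)"
| "eval I (Disj \<phi> \<psi>) = max (eval I \<phi>) (eval I \<psi>)"
| "eval I (Arrow \<phi> \<psi>) = arrow_val (eval I \<phi>) (eval I \<psi>)"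
| "eval I (Times \<phi> \<psi>) = times_val (eval I \<phi>) (eval I \<psi>)"
| "eval I (Naf \<phi>) = naf_val (eval I \<phi>)"

text \<open>\<open>Rule [C\<^sub>1,\<dots>,C\<^sub>n] [A\<^sub>1,\<dots>,A\<^sub>m] [B\<^sub>1,\<dots>,B\<^sub>k]\<close> is the rule
  \<open>C\<^sub>1 \<times> \<dots> \<times> C\<^sub>n \<leftarrow> A\<^sub>1, \<dots>, A\<^sub>m, not B\<^sub>1, \<dots>, not B\<^sub>k\<close>.\<close>

datatype 'a rule = Rule (head: "'a list") (pos: "'a list") (neg: "'a list")

fun times_list :: "'a fm list \<Rightarrow> 'a fm" where
  "times_list [\<phi>] = \<phi>"
| "times_list (\<phi> # \<psi> # \<phi>s) = Times \<phi> (times_list (\<psi> # \<phi>s))"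

fun conj_list :: "'a fm list \<Rightarrow> 'a fm" where
  "conj_list [\<phi>] = \<phi>"
| "conj_list (\<phi> # \<psi> # \<phi>s) = Conj \<phi> (conj_list (\<psi> # \<phi>s))"

definition body_literals :: "'a rule \<Rightarrow> 'a fm list" where
  "body_literals r = map Atom (pos r) @ map (\<lambda>B. Naf (Atom B)) (neg r)"

definition head_val :: "'a interp \<Rightarrow> 'a rule \<Rightarrow> tv" where
  "head_val I r = eval I (times_list (map Atom (head r)))"

text \<open>The empty body (\<open>m = k = 0\<close>) is not a formula; as the empty conjunction it has
  the greatest truth value.\<close>

definition body_val :: "'a interp \<Rightarrow> 'a rule \<Rightarrow> tv" where
  "body_val I r =
     (if body_literals r = [] then T else eval I (conj_list (body_literals r)))"

definition rule_val :: "'a interp \<Rightarrow> 'a rule \<Rightarrow> tv" where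
  "rule_val I r = arrow_val (head_val I r) (body_val I r)"

definition lpod :: "'a rule set \<Rightarrow> bool" where
  "lpod P \<longleftrightarrow> finite P \<and> (\<forall>r\<in>P. head r \<noteq> [])"

definition atoms_of :: "'a rule set \<Rightarrow> 'a set" where
  "atoms_of P = (\<Union>r\<in>P. set (head r) \<union> set (pos r) \<union> set (neg r))"

definition is_model :: "'a interp \<Rightarrow> 'a rule set \<Rightarrow> bool" where
  "is_model I P \<longleftrightarrow> (\<forall>r\<in>P. rule_val I r = T)"

definition logically_equivalent :: "'a rule set \<Rightarrow> 'a rule set \<Rightarrow> bool" where
  "logically_equivalent P Q \<longleftrightarrow> {I. is_model I P} = {I. is_model I Q}"

definition tv_prec :: "tv \<Rightarrow> tv \<Rightarrow> bool" where
  "tv_prec v w \<longleftrightarrow> (v, w) \<in> {(F, Fs), (F, Ts), (F, T), (Ts, T)}"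

definition tv_preceq :: "tv \<Rightarrow> tv \<Rightarrow> bool" where
  "tv_preceq v w \<longleftrightarrow> tv_prec v w \<or> v = w"

text \<open>An interpretation \<^emph>\<open>of\<close> \<open>P\<close> assigns values to the atoms of \<open>P\<close> only; it is represented
  by the total interpretation that is \<open>F\<close> on all other atoms. Without such a convention the
  strict order below would relate interpretations that differ only outside \<open>P\<close> in both
  directions, and no program would have minimal models.\<close>

definition interp_of :: "'a rule set \<Rightarrow> 'a interp \<Rightarrow> bool" where
  "interp_of P I \<longleftrightarrow> (\<forall>A. A \<notin> atoms_of P \<longrightarrow> I A = F)"

definition interp_preceq :: "'a rule set \<Rightarrow> 'a interp \<Rightarrow> 'a interp \<Rightarrow> bool" where
  "interp_preceq P I J \<longleftrightarrow> (\<forall>A\<in>atoms_of P. tv_preceq (I A) (J A))"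

definition interp_prec :: "'a rule set \<Rightarrow> 'a interp \<Rightarrow> 'a interp \<Rightarrow> bool" where
  "interp_prec P I J \<longleftrightarrow> interp_preceq P I J \<and> I \<noteq> J"

definition solid :: "'a rule set \<Rightarrow> 'a interp \<Rightarrow> bool" where
  "solid P I \<longleftrightarrow> (\<forall>A\<in>atoms_of P. I A \<noteq> Ts)"

definition minimal_model :: "'a rule set \<Rightarrow> 'a interp \<Rightarrow> bool" where
  "minimal_model P I \<longleftrightarrow>
     interp_of P I \<and> is_model I P \<and>
     \<not> (\<exists>J. interp_of P J \<and> is_model J P \<and> interp_prec P J I)"

definition answer_set :: "'a rule set \<Rightarrow> 'a interp \<Rightarrow> bool" where
  "answer_set P I \<longleftrightarrow> minimal_model P I \<and> solid P I"

definition strongly_equivalent :: "'a rule set \<Rightarrow> 'a rule set \<Rightarrow> bool" where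
  "strongly_equivalent P Q \<longleftrightarrow>
     (\<forall>R. lpod R \<longrightarrow> {I. answer_set (P \<union> R) I} = {I. answer_set (Q \<union> R) I})"

lemma eval_times_list_cong:
  "xs \<noteq> [] \<Longrightarrow> (\<And>A. A \<in> set xs \<Longrightarrow> I A = J A) \<Longrightarrow>
    eval I (times_list (map Atom xs)) = eval J (times_list (map Atom xs))"
proof (induction xs rule: induct_list012)
  case (3 x y zs)
  then show ?case by simp
qed auto

lemma eval_conj_list_cong:
  "\<phi>s \<noteq> [] \<Longrightarrow> (\<And>\<phi>. \<phi> \<in> set \<phi>s \<Longrightarrow> eval I \<phi> = eval J \<phi>) \<Longrightarrow>
    eval I (conj_list \<phi>s) = eval J (conj_list \<phi>s)"
proof (induction \<phi>s rule: induct_list012)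
  case (3 x y zs)
  then show ?case by simp
qed auto

lemma is_model_cong:
  assumes "lpod P" "\<And>A. A \<in> atoms_of P \<Longrightarrow> I A = J A"
  shows "is_model I P \<longleftrightarrow> is_model J P"
proof -
  have "rule_val I r = rule_val J r" if r: "r \<in> P" for r
  proof -
    have eq: "I A = J A" if "A \<in> set (head r) \<union> set (pos r) \<union> set (neg r)" for A
      using assms(2) r that by (auto simp: atoms_of_def)
    have "head_val I r = head_val J r"
      unfolding head_val_def using assms(1) r eq
      by (intro eval_times_list_cong) (auto simp: lpod_def)
    moreover have "body_val I r = body_val J r"
    proof (cases "body_literals r = []")
      case False
      then have "eval I (conj_list (body_literals r)) = eval J (conj_list (body_literals r))"
        by (rule eval_conj_list_cong) (auto simp: body_literals_def eq)
      then show ?thesis by (simp add: body_val_def)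
    qed (simp add: body_val_def)
    ultimately show ?thesis by (simp add: rule_val_def)
  qed
  then show ?thesis by (simp add: is_model_def)
qed

text \<open>The same notion results if all of \<open>\<Sigma>\<close> takes part in the comparison of interpretations:
  minimality then forces \<open>F\<close> on the atoms that do not occur in the program.\<close>

lemma answer_set_iff_all_atoms:
  assumes "lpod P"
  shows "answer_set P I \<longleftrightarrow> is_model I P \<and> (\<forall>A. I A \<noteq> Ts) \<and>
    \<not> (\<exists>J. is_model J P \<and> (\<forall>A. tv_preceq (J A) (I A)) \<and> J \<noteq> I)"
    (is "_ \<longleftrightarrow> ?R")
proof
  assume a: "answer_set P I"
  then have I: "interp_of P I" "is_model I P" "solid P I"
    by (auto simp: answer_set_def minimal_model_def)
  have "J = I" if J: "is_model J P" "\<forall>A. tv_preceq (J A) (I A)" for J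
  proof -
    have "interp_of P J"
      using I(1) J(2) unfolding interp_of_def tv_preceq_def tv_prec_def by fastforce
    then show ?thesis
      using a J by (auto simp: answer_set_def minimal_model_def interp_prec_def interp_preceq_def)
  qed
  moreover have "I A \<noteq> Ts" for A
    using I by (cases "A \<in> atoms_of P") (auto simp: solid_def interp_of_def)
  ultimately show ?R using I by blast
next
  assume R: ?R
  define J where "J = (\<lambda>A. if A \<in> atoms_of P then I A else F)"
  have "is_model J P"
    using R is_model_cong[OF assms, of J I] by (auto simp: J_def)
  moreover have "tv_preceq (J A) (I A)" for A
    by (cases "I A") (auto simp: J_def tv_preceq_def tv_prec_def)
  ultimately have "J = I" using R by blast
  then have of: "interp_of P I"
    by (metis J_def interp_of_def)
  have "\<not> interp_prec P K I" if K: "interp_of P K" "is_model K P" for K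
  proof
    assume p: "interp_prec P K I"
    have "tv_preceq (K A) (I A)" for A
      using p K(1) of
      by (cases "A \<in> atoms_of P")
        (auto simp: interp_prec_def interp_preceq_def interp_of_def tv_preceq_def)
    then show False using R K(2) p by (auto simp: interp_prec_def)
  qed
  then show "answer_set P I"
    using R of by (auto simp: answer_set_def minimal_model_def solid_def)
qed

end

theory Submission
  imports Defs
begin

text \<open>Logically equivalent programs stay so after adding any \<open>R\<close>, and answer sets depend only on
  the models. Conversely, let \<open>N\<close> be a model of \<open>P\<close> but not of \<open>Q\<close>; by changing it outside \<open>P\<close> and
  \<open>Q\<close> we may assume that it is \<open>F\<close> almost everywhere and \<open>T\<close> somewhere. Replacing \<open>T\<^sup>*\<close> by \<open>T\<close> in a
  model yields a model; let \<open>N'\<close> be obtained from \<open>N\<close> in this way. There is a program \<open>R N\<close> whose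
  only models below \<open>N'\<close> are \<open>N\<close> and \<open>N'\<close>. If \<open>N'\<close> is a model of \<open>Q\<close>, then \<open>N'\<close> is an answer set
  of \<open>Q \<union> R N\<close>, but not of \<open>P \<union> R N\<close>, because \<open>N\<close> is smaller. Otherwise \<open>N'\<close> is an answer set of
  \<open>P \<union> R N'\<close>, but not even a model of \<open>Q\<close>.\<close>

fun promote :: "tv \<Rightarrow> tv" where
  "promote Ts = T"
| "promote F = F"
| "promote Fs = Fs"
| "promote T = T"

lemma promote_neq_Ts [simp]: "promote v \<noteq> Ts"
  by (cases v) auto

lemma promote_idem [simp]: "promote (promote v) = promote v"
  by (cases v) auto

lemma promote_eq_F_iff [simp]: "promote v = F \<longleftrightarrow> v = F"
  by (cases v) auto

lemma tv_preceq_promote: "tv_preceq v (promote v)"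
  by (cases v) (auto simp: tv_preceq_def tv_prec_def)

lemma promote_mono: "v \<le> w \<Longrightarrow> promote v \<le> promote w"
  by (cases v; cases w) (auto simp: less_eq_tv_def)

lemma promote_min: "promote (min v w) = min (promote v) (promote w)"
  by (cases v; cases w) (auto simp: less_eq_tv_def min_def)

lemma promote_times_val: "promote (times_val v w) = times_val (promote v) (promote w)"
  by (cases v; cases w) (auto simp: times_val_def)

lemma promote_naf_val: "promote (naf_val v) = naf_val (promote v)"
  by (cases v) (auto simp: naf_val_def less_eq_tv_def)

lemma eval_times_list_promote:
  "As \<noteq> [] \<Longrightarrow>
    eval (promote \<circ> I) (times_list (map Atom As)) = promote (eval I (times_list (map Atom As)))"
  by (induction As rule: induct_list012) (auto simp: promote_times_val)

lemma eval_conj_list_promote: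
  assumes "\<phi>s \<noteq> []" "\<And>\<phi>. \<phi> \<in> set \<phi>s \<Longrightarrow> eval (promote \<circ> I) \<phi> = promote (eval I \<phi>)"
  shows "eval (promote \<circ> I) (conj_list \<phi>s) = promote (eval I (conj_list \<phi>s))"
  using assms by (induction \<phi>s rule: induct_list012) (auto simp: promote_min)

lemma body_val_promote: "body_val (promote \<circ> I) r = promote (body_val I r)"
proof (cases "body_literals r = []")
  case False
  then have "eval (promote \<circ> I) (conj_list (body_literals r)) =
      promote (eval I (conj_list (body_literals r)))"
    by (rule eval_conj_list_promote) (auto simp: body_literals_def promote_naf_val)
  then show ?thesis by (simp add: body_val_def)
qed (simp add: body_val_def)

lemma rule_val_eq_T_iff: "rule_val I r = T \<longleftrightarrow> body_val I r \<le> head_val I r"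
  by (simp add: rule_val_def arrow_val_def)

text \<open>\<open>promote\<close> commutes with \<open>min\<close>, \<open>times_val\<close> and
  \<open>naf_val\<close>, and its monotonicity preserves body \<le> head.\<close>

lemma is_model_promote:
  assumes "lpod P" "is_model I P"
  shows "is_model (promote \<circ> I) P"
  using assms promote_mono
  by (auto simp: is_model_def lpod_def rule_val_eq_T_iff body_val_promote head_val_def
      eval_times_list_promote)

lemma is_model_Un: "is_model I (P \<union> Q) \<longleftrightarrow> is_model I P \<and> is_model I Q"
  by (auto simp: is_model_def)

lemma lpod_Un: "lpod P \<Longrightarrow> lpod Q \<Longrightarrow> lpod (P \<union> Q)"
  by (auto simp: lpod_def)

lemma finite_atoms_of: "lpod P \<Longrightarrow> finite (atoms_of P)"
  by (auto simp: lpod_def atoms_of_def)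

text \<open>In an interpretation where \<open>c\<close> is \<open>T\<close>, the rule \<open>A \<times> c\<close> excludes the value \<open>F\<close> for \<open>A\<close> but
  permits \<open>F\<^sup>*\<close>; the rule \<open>A \<leftarrow> not A\<close> holds iff \<open>A\<close> is \<open>T\<^sup>*\<close> or \<open>T\<close>; and the rules \<open>A \<leftarrow> B\<close> give
  all \<open>T\<^sup>*\<close>-atoms of \<open>N\<close> the same value.\<close>

definition characteristic_program :: "'a \<Rightarrow> 'a interp \<Rightarrow> 'a rule set" where
  "characteristic_program c N =
     (\<lambda>A. Rule [A] [] []) ` {A. N A = T} \<union>
     (\<lambda>A. Rule [A, c] [] []) ` {A. N A = Fs} \<union>
     (\<lambda>A. Rule [A] [] [A]) ` {A. N A = Ts} \<union>
     (\<lambda>(A, B). Rule [A] [B] []) ` ({A. N A = Ts} \<times> {B. N B = Ts})"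

lemma lpod_characteristic_program:
  assumes "finite {A. N A \<noteq> F}"
  shows "lpod (characteristic_program c N)"
proof -
  have "finite {A. N A = v}" if "v \<noteq> F" for v
    by (rule finite_subset[OF _ assms]) (use that in auto)
  then show ?thesis
    by (auto simp: lpod_def characteristic_program_def)
qed

lemma T_le_iff [simp]: "T \<le> v \<longleftrightarrow> v = T"
  by (cases v) (auto simp: less_eq_tv_def)

lemma is_model_characteristic_program_iff:
  "is_model I (characteristic_program c N) \<longleftrightarrow>
     (\<forall>A. N A = T \<longrightarrow> I A = T) \<and>
     (\<forall>A. N A = Fs \<longrightarrow> times_val (I A) (I c) = T) \<and>
     (\<forall>A. N A = Ts \<longrightarrow> naf_val (I A) \<le> I A) \<and>
     (\<forall>A B. N A = Ts \<longrightarrow> N B = Ts \<longrightarrow> I B \<le> I A)"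
  unfolding is_model_def characteristic_program_def ball_Un image_image ball_simps mem_Collect_eq
  by (auto simp: rule_val_eq_T_iff head_val_def body_val_def body_literals_def)

lemma is_model_characteristic_program:
  "N c = T \<Longrightarrow> is_model N (characteristic_program c N)"
  by (auto simp: is_model_characteristic_program_iff times_val_def naf_val_def less_eq_tv_def)

lemma characteristic_program_models:
  assumes "N c = T" and J: "is_model J (characteristic_program c N)"
    and le: "\<And>A. tv_preceq (J A) (promote (N A))"
  shows "J = N \<or> J = promote \<circ> N"
proof -
  note J = J[unfolded is_model_characteristic_program_iff]
  have c: "J c = T" using J assms(1) by blast
  \<comment> \<open>If \<open>N A = F\<close>, the bound forces \<open>F\<close>; if
    \<open>N A = Fs\<close>, it leaves \<open>F\<close> and \<open>Fs\<close>, and the rule with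
    \<open>c\<close> excludes \<open>F\<close>.\<close>
  have eq: "J A = N A" if "N A \<noteq> Ts" for A
    using that J c le[of A]
    by (cases "N A") (auto simp: tv_preceq_def tv_prec_def times_val_def split: if_splits)
  have Ts: "J A = Ts \<or> J A = T" if "N A = Ts" for A
    using that J le[of A]
    by (cases "J A") (auto simp: naf_val_def less_eq_tv_def tv_preceq_def tv_prec_def)
  show ?thesis
  proof (cases "\<exists>A. N A = Ts \<and> J A = T")
    case True
    then have "J A = T" if "N A = Ts" for A
      using that J by (metis T_le_iff)
    then have "J A = promote (N A)" for A
      using eq[of A] by (cases "N A") auto
    then show ?thesis by auto
  next
    case False
    then have "J A = N A" for A
      using eq[of A] Ts[of A] by (cases "N A = Ts") auto
    then show ?thesis by auto
  qed
qed

text \<open>Only \<open>N\<close> could compete with \<open>promote \<circ> N\<close>; the last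
  assumption excludes this unless the two coincide.\<close>

lemma answer_set_promote:
  assumes "lpod P" "finite {A. N A \<noteq> F}" "N c = T"
    and "is_model (promote \<circ> N) P" "is_model N P \<Longrightarrow> promote \<circ> N = N"
  shows "answer_set (P \<union> characteristic_program c N) (promote \<circ> N)"
proof -
  let ?R = "characteristic_program c N"
  have R: "lpod ?R" using assms(2) by (rule lpod_characteristic_program)
  have "is_model (promote \<circ> N) ?R"
    using is_model_promote[OF R] is_model_characteristic_program[of N c] assms(3) by simp
  moreover have "J = promote \<circ> N"
    if "is_model J (P \<union> ?R)" "\<forall>A. tv_preceq (J A) ((promote \<circ> N) A)" for J
    using characteristic_program_models[of N c J] that assms(3,5) by (auto simp: is_model_Un)
  ultimately show ?thesis
    unfolding answer_set_iff_all_atoms[OF lpod_Un[OF assms(1) R]]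
    using assms(4) by (auto simp: is_model_Un)
qed

lemma distinguishing_context:
  assumes "lpod P" "lpod Q" "is_model N P" "\<not> is_model N Q"
    and fin: "finite {A. N A \<noteq> F}" and c: "N c = T"
  shows "\<not> strongly_equivalent P Q"
proof (cases "is_model (promote \<circ> N) Q")
  case True
  let ?R = "characteristic_program c N"
  have R: "lpod ?R" using fin by (rule lpod_characteristic_program)
  have "answer_set (Q \<union> ?R) (promote \<circ> N)"
    using answer_set_promote[OF assms(2) fin c True] assms(4) by blast
  moreover have "\<not> answer_set (P \<union> ?R) (promote \<circ> N)"
  proof -
    have "is_model N (P \<union> ?R)"
      using assms(3) is_model_characteristic_program[of N c] c by (simp add: is_model_Un)
    moreover have "N \<noteq> promote \<circ> N" using True assms(4) by metis
    moreover have "\<forall>A. tv_preceq (N A) ((promote \<circ> N) A)" by (simp add: tv_preceq_promote)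
    ultimately show ?thesis
      unfolding answer_set_iff_all_atoms[OF lpod_Un[OF assms(1) R]] by blast
  qed
  ultimately show ?thesis using R unfolding strongly_equivalent_def by blast
next
  case False
  \<comment> \<open>\<open>?M\<close> has no \<open>Ts\<close> and is its own promotion, so it has
    no competitor.\<close>
  let ?M = "promote \<circ> N"
  let ?R = "characteristic_program c ?M"
  have M: "finite {A. ?M A \<noteq> F}" "?M c = T" "promote \<circ> ?M = ?M"
    using fin c by (auto simp: fun_eq_iff)
  have "answer_set (P \<union> ?R) ?M"
    using answer_set_promote[of P ?M c] M is_model_promote assms(1,3) by auto
  moreover have "\<not> answer_set (Q \<union> ?R) ?M"
    using False by (auto simp: answer_set_def minimal_model_def is_model_Un)
  moreover have "lpod ?R" using M(1) by (rule lpod_characteristic_program)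
  ultimately show ?thesis unfolding strongly_equivalent_def by blast
qed

lemma is_model_transfer:
  fixes P Q :: "'a::infinite rule set"
  assumes "lpod P" "lpod Q" "strongly_equivalent P Q" "is_model M P"
  shows "is_model M Q"
proof (rule ccontr)
  assume not: "\<not> is_model M Q"
  define S where "S = atoms_of P \<union> atoms_of Q"
  have fin: "finite S" using assms(1,2) by (simp add: S_def finite_atoms_of)
  then obtain c where c: "c \<notin> S"
    using ex_new_if_finite infinite_UNIV by blast
  \<comment> \<open>The value \<open>F\<close> outside a finite set keeps the characteristic program
    finite; the fresh \<open>c\<close> supplies an atom with value \<open>T\<close>.\<close>
  define N where "N = (\<lambda>A. if A \<in> S then M A else if A = c then T else F)"
  have "finite {A. N A \<noteq> F}"
    by (rule finite_subset[of _ "insert c S"]) (use fin in \<open>auto simp: N_def\<close>)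
  moreover have "N c = T" using c by (simp add: N_def)
  moreover have "is_model N P \<longleftrightarrow> is_model M P" "is_model N Q \<longleftrightarrow> is_model M Q"
    by (rule is_model_cong; use assms(1,2) in \<open>simp add: N_def S_def\<close>)+
  ultimately show False
    using distinguishing_context[OF assms(1,2), of N c] assms(3,4) not by simp
qed

lemma strongly_equivalent_sym: "strongly_equivalent P Q \<Longrightarrow> strongly_equivalent Q P"
  by (simp add: strongly_equivalent_def)

text \<open>Comparing on all atoms makes answer sets depend on the models alone, even if
  \<open>P\<close> and \<open>Q\<close> have different atoms.\<close>

lemma logically_equivalent_imp_strongly_equivalent:
  assumes "lpod P" "lpod Q" "logically_equivalent P Q"
  shows "strongly_equivalent P Q"
proof -
  have "is_model I P \<longleftrightarrow> is_model I Q" for I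
    using assms(3) by (auto simp: logically_equivalent_def)
  then show ?thesis
    using assms(1,2)
    by (simp add: strongly_equivalent_def answer_set_iff_all_atoms lpod_Un is_model_Un)
qed

theorem theorem2:
  fixes P1 P2 :: "'a::{countable,infinite} rule set"
  assumes "lpod P1" and "lpod P2"
  shows "strongly_equivalent P1 P2 \<longleftrightarrow> logically_equivalent P1 P2"
proof
  assume "strongly_equivalent P1 P2"
  then show "logically_equivalent P1 P2"
    using assms is_model_transfer strongly_equivalent_sym
    unfolding logically_equivalent_def by blast
next
  assume "logically_equivalent P1 P2"
  then show "strongly_equivalent P1 P2"
    using assms by (rule logically_equivalent_imp_strongly_equivalent[rotated 2])
qed

end
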